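(* Let $\gamma = \lim_{N\to\infty}\left(1+\frac12+\frac13+\cdots+\frac1N-\ln N\right)$ be Euler's constant. Then $$\gamma = \sum_{n=1}^{\infty}\left(\frac{1}{n}-\ln\frac{n+1}{n}\right) = \iint_{[0,1]^2}\frac{1-x}{(1-xy)(-\ln xy)}\,dx\,dy .$$
   Context: Here $\ln$ is the natural logarithm and $\ln xy$ means $\ln(xy)$. The integrand is defined for $0<x<1$, $0<y<1$, i.e. almost everywhere on the unit square, and the (improper) double integral is taken over the unit square $[0,1]^2$. *)

theory Defs
  imports "HOL-Analysis.Analysis"
begin

end

theory Submission
  imports Defs "HOL-Real_Asymp.Real_Asymp"
begin

text \<open>
  For \<open>0 < u < 1\<close> the geometric series and \<open>u ^ n / (- ln u) = \<integral> u powr t dt\<close>, taken over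
  \<open>t \<ge> n\<close>, give \<open>1 / ((1 - u) * (- ln u)) = (\<Sum>n. \<integral> u powr t dt)\<close>. With \<open>u = x * y\<close> this writes
  the integrand as a sum of integrals of nonnegative functions (lemma \<open>integrand_expansion\<close>), so
  by Tonelli's theorem the integration over the unit square may be carried out first. There the
  variables separate, and \<open>(1 - x) * (x * y) powr t\<close> integrates to
  \<open>1 / ((t + 1)\<^sup>2 * (t + 2))\<close>. Integrating this over \<open>t \<ge> n\<close> gives
  \<open>1 / (n + 1) - ln ((n + 2) / (n + 1))\<close> (lemma \<open>nn_integral_euler_term\<close>), the general term of
  the series for Euler's constant. As that series converges, the double integral is finite, and
  integrability and the value of the integral both follow.
\<close>

lemma euler_mascheroni_sums_ln_quotient:
  "(\<lambda>n. 1 / real (Suc n) - ln (real (Suc n + 1) / real (Suc n))) sums (euler_mascheroni :: real)"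
proof -
  have "(\<lambda>n. 1 / real (Suc n) - ln (real (Suc n + 1) / real (Suc n)))
      = (\<lambda>n. inverse (of_nat (n+1)) + ln (of_nat (n+1)) - ln (of_nat (n+2)) :: real)"
    by (auto simp: ln_div inverse_eq_divide)
  then show ?thesis
    using euler_mascheroni_sum_real by simp
qed

lemma nn_integral_powr_atLeast:
  assumes "0 < u" "u < (1::real)"
  shows "(\<integral>\<^sup>+t. ennreal (u powr t) * indicator {a..} t \<partial>lborel) = ennreal (u powr a / (- ln u))"
proof -
  have ln0: "ln u < 0"
    using assms by simp
  have "((\<lambda>t. u powr t) \<longlongrightarrow> 0) at_top"
    using assms ln0 unfolding powr_def
    by (auto intro!: filterlim_compose[OF exp_at_bot] filterlim_tendsto_neg_mult_at_bot
        [where c = "ln u"] filterlim_ident simp: mult.commute[of _ "ln u"])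
  then have lim: "((\<lambda>t. u powr t / ln u) \<longlongrightarrow> 0) at_top"
    using tendsto_divide_zero by blast
  have "(\<integral>\<^sup>+t. ennreal (u powr t) * indicator {a..} t \<partial>lborel) = ennreal (0 - u powr a / ln u)"
  proof (rule nn_integral_FTC_atLeast[OF _ _ _ lim])
    show "DERIV (\<lambda>t. u powr t / ln u) t :> u powr t" if "a \<le> t" for t
      using assms ln0 by (auto intro!: derivative_eq_intros)
  qed auto
  then show ?thesis
    by simp
qed

text \<open>The values that HOL assigns on the boundary agree: both sides vanish for \<open>x = 0\<close> and
  \<open>y = 0\<close> because \<open>0 powr t = 0\<close> and \<open>ln 0 = 0\<close>, and for \<open>x = 1\<close> because of the factor
  \<open>1 - x\<close>. The identity therefore holds on the closed square.\<close>

lemma integrand_expansion: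
  fixes x y :: real
  assumes "x \<in> {0..1}" "y \<in> {0..1}"
  shows "(\<Sum>n. \<integral>\<^sup>+t. ennreal ((1 - x) * (x * y) powr t) * indicator {real n..} t \<partial>lborel)
       = ennreal ((1 - x) / ((1 - x * y) * (- ln (x * y))))"
proof (cases "x = 0 \<or> y = 0 \<or> x = 1")
  case True
  then show ?thesis by auto
next
  case False
  define u where "u = x * y"
  have x: "0 < x" "x < 1" and y: "0 < y" "y \<le> 1"
    using False assms by auto
  have u: "0 < u" "u < 1"
    using x y mult_less_le_imp_less[of x 1 y 1] by (auto simp: u_def)
  have ln0: "ln u < 0"
    using u by simp
  have "(\<integral>\<^sup>+t. ennreal ((1 - x) * u powr t) * indicator {real n..} t \<partial>lborel)
      = ennreal ((1 - x) / (- ln u) * u ^ n)" for n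
  proof -
    have "(\<integral>\<^sup>+t. ennreal ((1 - x) * u powr t) * indicator {real n..} t \<partial>lborel)
        = (\<integral>\<^sup>+t. ennreal (1 - x) * (ennreal (u powr t) * indicator {real n..} t) \<partial>lborel)"
      using x by (simp add: ennreal_mult mult.assoc)
    also have "\<dots> = ennreal (1 - x) * ennreal (u powr real n / (- ln u))"
      by (subst nn_integral_cmult) (auto simp only: nn_integral_powr_atLeast[OF u], measurable)
    also have "\<dots> = ennreal ((1 - x) * (u powr real n / (- ln u)))"
      using x ln0 by (intro ennreal_mult[symmetric] divide_nonneg_nonneg) auto
    finally show ?thesis
      using u by (simp add: powr_realpow)
  qed
  moreover have "(\<lambda>n. (1 - x) / (- ln u) * u ^ n) sums ((1 - x) / (- ln u) * (1 / (1 - u)))"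
    using u by (intro sums_mult geometric_sums) auto
  then have "(\<Sum>n. ennreal ((1 - x) / (- ln u) * u ^ n))
      = ennreal ((1 - x) / (- ln u) * (1 / (1 - u)))"
    using x u ln0
    by (intro suminf_ennreal_eq mult_nonneg_nonneg divide_nonneg_nonneg) auto
  ultimately show ?thesis
    by (simp add: u_def mult.commute)
qed

lemma nn_integral_powr_unit_interval:
  assumes "t > (-1::real)"
  shows "(\<integral>\<^sup>+y. ennreal (y powr t) * indicator {0..1} y \<partial>lborel) = ennreal (1 / (t + 1))"
  using has_integral_powr_from_0[OF assms, of 1]
  by (intro nn_integral_has_integral_lebesgue') auto

lemma nn_integral_one_minus_powr_unit_interval:
  assumes "t > (-1::real)"
  shows "(\<integral>\<^sup>+x. ennreal ((1 - x) * x powr t) * indicator {0..1} x \<partial>lborel)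
       = ennreal (1 / (t + 1) - 1 / (t + 2))"
proof (rule nn_integral_has_integral_lebesgue')
  have "((\<lambda>x. x powr t - x powr (t + 1)) has_integral (1 / (t + 1) - 1 / (t + 2))) {0..1}"
    using has_integral_diff[OF has_integral_powr_from_0[of t 1] has_integral_powr_from_0[of "t + 1" 1]]
      assms by (simp add: add.assoc)
  then show "((\<lambda>x. (1 - x) * x powr t) has_integral (1 / (t + 1) - 1 / (t + 2))) {0..1}"
    by (rule has_integral_eq[rotated]) (auto simp: powr_mult_base algebra_simps)
qed auto

lemma nn_integral_unit_square:
  assumes "t > (-1::real)"
  shows "(\<integral>\<^sup>+x. \<integral>\<^sup>+y. ennreal ((1 - x) * (x * y) powr t) * indicator {0..1} x * indicator {0..1} y
            \<partial>lborel \<partial>lborel)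
       = ennreal (1 / ((t + 1)\<^sup>2 * (t + 2)))"
proof -
  have "(\<integral>\<^sup>+y. ennreal ((1 - x) * (x * y) powr t) * indicator {0..1} x * indicator {0..1} y \<partial>lborel)
      = ennreal ((1 - x) * x powr t) * indicator {0..1} x * ennreal (1 / (t + 1))" for x :: real
  proof -
    have "(\<integral>\<^sup>+y. ennreal ((1 - x) * (x * y) powr t) * indicator {0..1} x * indicator {0..1} y \<partial>lborel)
      = (\<integral>\<^sup>+y. ennreal ((1 - x) * x powr t) * indicator {0..1} x *
             (ennreal (y powr t) * indicator {0..1} y) \<partial>lborel)"
      by (intro nn_integral_cong)
        (auto simp: indicator_def powr_mult simp flip: ennreal_mult mult.assoc)
    also have "\<dots> = ennreal ((1 - x) * x powr t) * indicator {0..1} x * ennreal (1 / (t + 1))"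
      by (subst nn_integral_cmult) (auto simp only: nn_integral_powr_unit_interval[OF assms], measurable)
    finally show ?thesis .
  qed
  then have "(\<integral>\<^sup>+x. \<integral>\<^sup>+y. ennreal ((1 - x) * (x * y) powr t) * indicator {0..1} x * indicator {0..1} y
            \<partial>lborel \<partial>lborel)
    = (\<integral>\<^sup>+x. ennreal ((1 - x) * x powr t) * indicator {0..1} x * ennreal (1 / (t + 1)) \<partial>lborel)"
    by simp
  also have "\<dots> = ennreal (1 / (t + 1) - 1 / (t + 2)) * ennreal (1 / (t + 1))"
    by (subst nn_integral_multc)
      (auto simp only: nn_integral_one_minus_powr_unit_interval[OF assms], measurable)
  also have "\<dots> = ennreal ((1 / (t + 1) - 1 / (t + 2)) * (1 / (t + 1)))"
    using assms by (intro ennreal_mult[symmetric]) (auto intro!: frac_le)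
  also have "(1 / (t + 1) - 1 / (t + 2)) * (1 / (t + 1)) = 1 / ((t + 1)\<^sup>2 * (t + 2))"
    using assms by (simp add: divide_simps power2_eq_square)
  finally show ?thesis .
qed

lemma nn_integral_euler_term:
  assumes "a > (-1::real)"
  shows "(\<integral>\<^sup>+t. ennreal (1 / ((t + 1)\<^sup>2 * (t + 2))) * indicator {a..} t \<partial>lborel)
       = ennreal (1 / (a + 1) - ln ((a + 2) / (a + 1)))"
proof -
  define F where "F = (\<lambda>t::real. ln (1 + 1 / (t + 1)) - 1 / (t + 1))"
  have lim: "(F \<longlongrightarrow> 0) at_top"
    unfolding F_def by real_asymp
  have "(\<integral>\<^sup>+t. ennreal (1 / ((t + 1)\<^sup>2 * (t + 2))) * indicator {a..} t \<partial>lborel) = ennreal (0 - F a)"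
  proof (rule nn_integral_FTC_atLeast[OF _ _ _ lim])
    fix t assume "a \<le> t"
    then have t: "t + 1 > 0"
      using assms by simp
    then have pos: "1 + 1 / (t + 1) > 0"
      by (simp add: add_pos_pos)
    show "DERIV F t :> 1 / ((t + 1)\<^sup>2 * (t + 2))"
      unfolding F_def using t pos
      by (auto intro!: derivative_eq_intros) (simp add: divide_simps power2_eq_square)
    show "0 \<le> 1 / ((t + 1)\<^sup>2 * (t + 2))"
      using t by simp
  qed auto
  also have "0 - F a = 1 / (a + 1) - ln ((a + 2) / (a + 1))"
    using assms by (simp add: F_def field_simps)
  finally show ?thesis .
qed

lemma nn_integral_euler_integrand:
  "(\<integral>\<^sup>+x. \<integral>\<^sup>+y. ennreal ((1 - x) / ((1 - x * y) * (- ln (x * y))))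
        * indicator {0..1} x * indicator {0..1} y \<partial>lborel \<partial>lborel)
     = ennreal euler_mascheroni"
proof -
  define K where "K = (\<lambda>t x y :: real.
    ennreal ((1 - x) * (x * y) powr t) * indicator {0..1} x * indicator {0..1} y)"
  define G where "G = (\<lambda>(n::nat) t x y. K t x y * indicator {real n..} t)"
  have G [measurable]: "(\<lambda>w. G n (f w) (g w) (h w)) \<in> borel_measurable M"
    if [measurable]: "f \<in> borel_measurable M" "g \<in> borel_measurable M" "h \<in> borel_measurable M"
    for n f g h and M :: "'m measure"
    unfolding G_def K_def by measurable
  have expand: "ennreal ((1 - x) / ((1 - x * y) * (- ln (x * y))))
        * indicator {0..1} x * indicator {0..1} y = (\<Sum>n. \<integral>\<^sup>+t. G n t x y \<partial>lborel)" for x y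
  proof (cases "x \<in> {0..1} \<and> y \<in> {0..1}")
    case True
    then show ?thesis
      using integrand_expansion[of x y] by (simp add: G_def K_def)
  next
    case False
    then have "G n t x y = 0" for n t
      by (auto simp: G_def K_def)
    with False show ?thesis by auto
  qed
  have "(\<integral>\<^sup>+x. \<integral>\<^sup>+y. ennreal ((1 - x) / ((1 - x * y) * (- ln (x * y))))
        * indicator {0..1} x * indicator {0..1} y \<partial>lborel \<partial>lborel)
      = (\<integral>\<^sup>+x. \<integral>\<^sup>+y. (\<Sum>n. \<integral>\<^sup>+t. G n t x y \<partial>lborel) \<partial>lborel \<partial>lborel)"
    unfolding expand ..
  also have "\<dots> = (\<Sum>n. \<integral>\<^sup>+x. \<integral>\<^sup>+y. \<integral>\<^sup>+t. G n t x y \<partial>lborel \<partial>lborel \<partial>lborel)"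
    by (subst nn_integral_suminf, measurable, subst nn_integral_suminf, measurable)
  also have "\<dots> = (\<Sum>n. ennreal (1 / real (Suc n) - ln (real (Suc n + 1) / real (Suc n))))"
  proof (rule arg_cong[where f = suminf], rule ext)
    fix n :: nat
    have "(\<integral>\<^sup>+x. \<integral>\<^sup>+y. \<integral>\<^sup>+t. G n t x y \<partial>lborel \<partial>lborel \<partial>lborel)
        = (\<integral>\<^sup>+x. \<integral>\<^sup>+t. \<integral>\<^sup>+y. G n t x y \<partial>lborel \<partial>lborel \<partial>lborel)"
      by (intro nn_integral_cong lborel_pair.Fubini') measurable
    also have "\<dots> = (\<integral>\<^sup>+t. \<integral>\<^sup>+x. \<integral>\<^sup>+y. G n t x y \<partial>lborel \<partial>lborel \<partial>lborel)"
      by (intro lborel_pair.Fubini') measurable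
    also have "\<dots> = (\<integral>\<^sup>+t. ennreal (1 / ((t + 1)\<^sup>2 * (t + 2))) * indicator {real n..} t \<partial>lborel)"
    proof (intro nn_integral_cong)
      fix t :: real
      show "(\<integral>\<^sup>+x. \<integral>\<^sup>+y. G n t x y \<partial>lborel \<partial>lborel)
          = ennreal (1 / ((t + 1)\<^sup>2 * (t + 2))) * indicator {real n..} t"
      proof (cases "real n \<le> t")
        case True
        then show ?thesis
          using nn_integral_unit_square[of t] by (simp add: G_def K_def)
      qed (simp add: G_def)
    qed
    also have "\<dots> = ennreal (1 / real (Suc n) - ln (real (Suc n + 1) / real (Suc n)))"
      by (subst nn_integral_euler_term) (auto simp: add_ac)
    finally show "(\<integral>\<^sup>+x. \<integral>\<^sup>+y. \<integral>\<^sup>+t. G n t x y \<partial>lborel \<partial>lborel \<partial>lborel)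
        = ennreal (1 / real (Suc n) - ln (real (Suc n + 1) / real (Suc n)))" .
  qed
  also have "\<dots> = ennreal euler_mascheroni"
  proof (intro suminf_ennreal_eq euler_mascheroni_sums_ln_quotient)
    fix n :: nat
    have "ln (real (Suc n + 1) / real (Suc n)) = ln (1 + 1 / real (Suc n))"
      by (simp add: field_simps)
    also have "\<dots> \<le> 1 / real (Suc n)"
      by (intro ln_add_one_self_le_self) auto
    finally show "0 \<le> 1 / real (Suc n) - ln (real (Suc n + 1) / real (Suc n))"
      by simp
  qed
  finally show ?thesis .
qed

theorem mainTheorem1:
  shows "(\<lambda>n. 1 / real (Suc n) - ln (real (Suc n + 1) / real (Suc n))) sums
           (euler_mascheroni :: real)
       \<and> set_integrable lborel ({0..1} \<times> {0..1})
           (\<lambda>(x :: real, y :: real). (1 - x) / ((1 - x * y) * (- ln (x * y))))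
       \<and> (euler_mascheroni :: real) =
           (LINT (x :: real, y :: real) : {0..1} \<times> {0..1} | lborel.
              (1 - x) / ((1 - x * y) * (- ln (x * y))))"
proof -
  define f :: "real \<times> real \<Rightarrow> real"
    where "f = (\<lambda>(x, y). (1 - x) / ((1 - x * y) * (- ln (x * y))))"
  define g where "g = (\<lambda>p. indicator ({0..1} \<times> {0..1}) p *\<^sub>R f p)"
  have f [measurable]: "f \<in> borel_measurable (borel \<Otimes>\<^sub>M borel)"
    unfolding f_def by measurable
  have g: "g \<in> borel_measurable (lborel \<Otimes>\<^sub>M lborel)"
    unfolding g_def by measurable
  have g_nonneg: "0 \<le> g p" for p
  proof (cases "p \<in> {0..1} \<times> {0..1}")
    case True
    then obtain x y where p: "p = (x, y)" and xy: "0 \<le> x" "x \<le> 1" "0 \<le> y" "y \<le> 1"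
      by auto
    have "x * y \<le> 1"
      using xy by (simp add: mult_le_one)
    moreover from this have "ln (x * y) \<le> 0"
      using xy by (cases "x * y = 0") auto
    ultimately show ?thesis
      using xy True by (auto simp: g_def f_def p intro!: divide_nonneg_nonpos mult_nonneg_nonpos)
  qed (simp add: g_def)
  have "(\<integral>\<^sup>+p. ennreal (g p) \<partial>lborel) = (\<integral>\<^sup>+p. ennreal (g p) \<partial>(lborel \<Otimes>\<^sub>M lborel))"
    by (simp only: lborel_prod)
  also have "\<dots> = (\<integral>\<^sup>+x. \<integral>\<^sup>+y. ennreal (g (x, y)) \<partial>lborel \<partial>lborel)"
    by (rule lborel.nn_integral_fst[symmetric]) (use g in measurable)
  also have "\<dots> = (\<integral>\<^sup>+x. \<integral>\<^sup>+y. ennreal ((1 - x) / ((1 - x * y) * (- ln (x * y))))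
        * indicator {0..1} x * indicator {0..1} y \<partial>lborel \<partial>lborel)"
    by (intro nn_integral_cong) (auto simp: g_def f_def indicator_def)
  also have "\<dots> = ennreal euler_mascheroni"
    by (rule nn_integral_euler_integrand)
  finally have "integrable lborel g \<and> integral\<^sup>L lborel g = euler_mascheroni"
    using g g_nonneg euler_mascheroni_pos
    by (subst (asm) nn_integral_eq_integrable) (auto simp: lborel_prod)
  then show ?thesis
    using euler_mascheroni_sums_ln_quotient
    unfolding set_integrable_def set_lebesgue_integral_def g_def f_def by simp
qed

end
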